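(* Let $G=(V,E)$ be a chordal graph. Then the set $\{\xi^W : W\subseteq V \text{ is an induced tree of } G\}$ of extended incidence vectors of induced trees of $G$ forms a Hilbert basis of the cone $\mathcal{C}_T(G)$; that is, all these vectors belong to $\mathcal{C}_T(G)$, and every integer point of $\mathcal{C}_T(G)$ is a nonnegative integer combination of them.
   Context: All graphs are finite and simple. A hole is an induced cycle of length at least 4; a graph is chordal if it has no hole. A clique is a set of pairwise adjacent vertices. An induced tree of $G$ is a (nonempty) vertex set $W\subseteq V$ such that the induced subgraph $G[W]$ is a tree (connected and acyclic). $E(W)$ denotes the set of edges of $G$ with both endpoints in $W$. The extended incidence vector of $W\subseteq V$ is $\xi^W=(\chi^W,\zeta^{E(W)})\in\{0,1\}^V\times\{0,1\}^E$, where $\chi^W$ is the 0/1 indicator vector of $W$ in $\mathbb{R}^V$ and $\zeta^{E(W)}$ the 0/1 indicator vector of $E(W)$ in $\mathbb{R}^E$. For $v\in V$, $\Omega^v$ denotes the set of inclusion-wise maximal cliques of $G$ containing $v$. $\mathcal{C}_T(G)$ is the cone of all $(x,y)\in\mathbb{R}^V\times\mathbb{R}^E$ satisfying $$\sum_{u\in K\setminus\{v\}} y_{uv}\le x_v\quad \forall v\in V,\ K\in\Omega^v;\qquad x_v\ge 0\quad\forall v\in V;\qquad y_e\ge 0\quad\forall e\in E.$$ *)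

theory Defs
  imports Complex_Main "HOL-Library.Indicator_Function"
begin

section \<open>Finite simple graphs\<close>

text \<open>An edge is the two-element set of its endpoints.\<close>

locale simple_graph =
  fixes V :: "'a set" and E :: "'a set set"
  assumes finite_vertices: "finite V"
    and edge_subset: "e \<in> E \<Longrightarrow> e \<subseteq> V"
    and edge_card: "e \<in> E \<Longrightarrow> card e = 2"

definition induced_edges :: "'a set set \<Rightarrow> 'a set \<Rightarrow> 'a set set" where
  "induced_edges E W = {e \<in> E. e \<subseteq> W}"

definition clique :: "'a set \<Rightarrow> 'a set set \<Rightarrow> 'a set \<Rightarrow> bool" where
  "clique V E K \<longleftrightarrow> K \<subseteq> V \<and> (\<forall>u\<in>K. \<forall>v\<in>K. u \<noteq> v \<longrightarrow> {u, v} \<in> E)"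

definition maximal_cliques_at :: "'a set \<Rightarrow> 'a set set \<Rightarrow> 'a \<Rightarrow> 'a set set" where
  "maximal_cliques_at V E v =
     {K. clique V E K \<and> v \<in> K \<and> (\<forall>K'. clique V E K' \<and> K \<subseteq> K' \<longrightarrow> K' = K)}"

text \<open>A cycle is given by the list of its vertices in cyclic order, without repeating the first
  vertex at the end; its length is the length of the list.\<close>

definition cycle_edges :: "'a list \<Rightarrow> 'a set set" where
  "cycle_edges xs = {{xs ! i, xs ! (Suc i mod length xs)} | i. i < length xs}"

definition is_cycle :: "'a set set \<Rightarrow> 'a list \<Rightarrow> bool" where
  "is_cycle E xs \<longleftrightarrow> 3 \<le> length xs \<and> distinct xs \<and> cycle_edges xs \<subseteq> E"

definition is_hole :: "'a set set \<Rightarrow> 'a list \<Rightarrow> bool" where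
  "is_hole E xs \<longleftrightarrow>
     is_cycle E xs \<and> induced_edges E (set xs) = cycle_edges xs \<and> 4 \<le> length xs"

definition chordal :: "'a set set \<Rightarrow> bool" where
  "chordal E \<longleftrightarrow> (\<nexists>xs. is_hole E xs)"

definition connected_graph :: "'a set \<Rightarrow> 'a set set \<Rightarrow> bool" where
  "connected_graph W F \<longleftrightarrow> (\<forall>u\<in>W. \<forall>v\<in>W. (u, v) \<in> {(a, b). {a, b} \<in> F}\<^sup>*)"

definition acyclic_graph :: "'a set set \<Rightarrow> bool" where
  "acyclic_graph F \<longleftrightarrow> (\<nexists>xs. is_cycle F xs)"

definition induced_tree :: "'a set \<Rightarrow> 'a set set \<Rightarrow> 'a set \<Rightarrow> bool" where
  "induced_tree V E W \<longleftrightarrow>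
     W \<noteq> {} \<and> W \<subseteq> V \<and>
     connected_graph W (induced_edges E W) \<and> acyclic_graph (induced_edges E W)"

section \<open>Extended incidence vectors and the cone\<close>

text \<open>Vectors of $\mathbb{R}^V \times \mathbb{R}^E$ are pairs of functions that vanish
  outside $V$ and outside $E$, respectively.\<close>

definition extended_incidence ::
    "'a set set \<Rightarrow> 'a set \<Rightarrow> ('a \<Rightarrow> real) \<times> ('a set \<Rightarrow> real)" where
  "extended_incidence E W = (indicator W, indicator (induced_edges E W))"

definition tree_cone :: "'a set \<Rightarrow> 'a set set \<Rightarrow> (('a \<Rightarrow> real) \<times> ('a set \<Rightarrow> real)) set" where
  "tree_cone V E =
     {(x, y). (\<forall>v. v \<notin> V \<longrightarrow> x v = 0) \<and> (\<forall>e. e \<notin> E \<longrightarrow> y e = 0) \<and>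
        (\<forall>v\<in>V. \<forall>K\<in>maximal_cliques_at V E v. (\<Sum>u\<in>K - {v}. y {u, v}) \<le> x v) \<and>
        (\<forall>v\<in>V. 0 \<le> x v) \<and> (\<forall>e\<in>E. 0 \<le> y e)}"

definition integer_point :: "('i \<Rightarrow> real) \<times> ('j \<Rightarrow> real) \<Rightarrow> bool" where
  "integer_point p \<longleftrightarrow> (\<forall>i. fst p i \<in> \<int>) \<and> (\<forall>j. snd p j \<in> \<int>)"

definition nonneg_int_combination ::
    "(('i \<Rightarrow> real) \<times> ('j \<Rightarrow> real)) set \<Rightarrow> ('i \<Rightarrow> real) \<times> ('j \<Rightarrow> real) \<Rightarrow> bool" where
  "nonneg_int_combination S p \<longleftrightarrow>
     (\<exists>F (c :: ('i \<Rightarrow> real) \<times> ('j \<Rightarrow> real) \<Rightarrow> nat). finite F \<and> F \<subseteq> S \<and>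
        p = (\<lambda>i. \<Sum>s\<in>F. real (c s) * fst s i, \<lambda>j. \<Sum>s\<in>F. real (c s) * snd s j))"

definition hilbert_basis ::
    "(('i \<Rightarrow> real) \<times> ('j \<Rightarrow> real)) set \<Rightarrow> (('i \<Rightarrow> real) \<times> ('j \<Rightarrow> real)) set \<Rightarrow> bool" where
  "hilbert_basis S C \<longleftrightarrow>
     S \<subseteq> C \<and> (\<forall>p\<in>C. integer_point p \<longrightarrow> nonneg_int_combination S p)"

end

theory Submission
  imports Defs
begin

text \<open>Induct on the vertex set by deleting a simplicial vertex $v$ with neighbourhood $N$.
  Decompose the restricted point into trees.  For $u$ in $N$, the constraint of $u$ for the clique
  $N$ with $v$ added says exactly that at least $y_{uv}$ of these trees meet $N$ in $u$ only;
  attach $v$ to that many of them.  The constraint of $v$ leaves a nonnegative number of copies of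
  the single vertex $v$ to be added.\<close>

section \<open>Simplicial vertices of chordal graphs\<close>

lemma rtrancl_imp_successively:
  assumes "(a, b) \<in> R\<^sup>*"
  shows "\<exists>p. p \<noteq> [] \<and> hd p = a \<and> last p = b \<and> successively (\<lambda>x y. (x, y) \<in> R) p"
  using assms
proof induction
  case base
  show ?case by (rule exI[of _ "[a]"]) simp
next
  case (step b c)
  then obtain p where "p \<noteq> []" "hd p = a" "last p = b" "successively (\<lambda>x y. (x, y) \<in> R) p"
    by blast
  with step.hyps(2) show ?case
    by (intro exI[of _ "p @ [c]"]) (simp add: successively_append_iff)
qed

text \<open>If positions \<open>i < j\<close> carry equal vertices, or adjacent ones with
  \<open>j > Suc i\<close>, then splicing the prefix through \<open>i\<close> to a later suffix
  gives a shorter walk with the same ends. Minimality is assumed only against walks inside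
  \<open>set xs\<close>, so that the lemma also serves for walks confined to a given vertex
  set.\<close>

lemma shortest_path_induced:
  assumes suc: "successively r xs"
    and shortest: "\<And>ys. \<lbrakk>ys \<noteq> []; hd ys = hd xs; last ys = last xs; successively r ys;
                     set ys \<subseteq> set xs\<rbrakk> \<Longrightarrow> length xs \<le> length ys"
    and ij: "i < j" "j < length xs"
  shows "xs ! i \<noteq> xs ! j" and "r (xs ! i) (xs ! j) \<Longrightarrow> j = Suc i"
proof -
  have [simp]: "last (take (Suc i) xs) = xs ! i"
    using ij by (simp add: take_Suc_conv_app_nth)
  have nt: "take (Suc i) xs \<noteq> []"
    using ij by auto
  have hdt: "hd (take (Suc i) xs) = hd xs"
    by simp
  have suc_td: "successively r (take k xs)" "successively r (drop k xs)" for k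
    using suc successively_append_iff[of r "take k xs" "drop k xs"] by simp_all
  have sub: "set (take (Suc i) xs @ drop k xs) \<subseteq> set xs" for k
    using set_take_subset[of "Suc i" xs] set_drop_subset[of k xs] by auto
  show "xs ! i \<noteq> xs ! j"
  proof
    assume eq: "xs ! i = xs ! j"
    have "length xs \<le> length (take (Suc i) xs @ drop (Suc j) xs)"
    proof (rule shortest)
      show "take (Suc i) xs @ drop (Suc j) xs \<noteq> []"
        using nt by simp
      show "hd (take (Suc i) xs @ drop (Suc j) xs) = hd xs"
        using nt hdt by simp
      show "set (take (Suc i) xs @ drop (Suc j) xs) \<subseteq> set xs"
        by (rule sub)
      show "last (take (Suc i) xs @ drop (Suc j) xs) = last xs"
      \<comment> \<open>When \<open>j\<close> is the last index the suffix is empty; the shortened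
        walk then ends in \<open>xs ! i\<close>, which equals \<open>xs ! j\<close>.\<close>
      proof (cases "Suc j < length xs")
        case True
        then show ?thesis by simp
      next
        case False
        then have "last xs = xs ! j"
          using ij by (metis Suc_lessI diff_Suc_1 last_conv_nth length_0_conv not_less_zero)
        with False eq show ?thesis by simp
      qed
      show "successively r (take (Suc i) xs @ drop (Suc j) xs)"
      proof (cases "Suc j < length xs")
        case True
        then have "r (xs ! j) (xs ! Suc j)"
          using suc by (simp add: successively_conv_nth)
        with True show ?thesis
          using suc_td eq by (simp add: successively_append_iff hd_drop_conv_nth)
      next
        case False
        then show ?thesis using suc_td by simp
      qed
    qed
    then show False using ij by simp
  qed
  show "j = Suc i" if "r (xs ! i) (xs ! j)"
  proof -
    have "length xs \<le> length (take (Suc i) xs @ drop j xs)"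
    proof (rule shortest)
      show "hd (take (Suc i) xs @ drop j xs) = hd xs"
        using nt hdt by simp
      show "successively r (take (Suc i) xs @ drop j xs)"
        using suc_td that ij by (simp add: successively_append_iff hd_drop_conv_nth)
      show "set (take (Suc i) xs @ drop j xs) \<subseteq> set xs"
        by (rule sub)
    qed (use ij nt in auto)
    then show ?thesis using ij by simp
  qed
qed

lemma card_2_doubletonE:
  assumes "card e = 2" "e \<subseteq> S"
  obtains a b where "e = {a, b}" "a \<noteq> b" "a \<in> S" "b \<in> S"
proof -
  obtain a b where "e = {a, b}" "a \<noteq> b" using assms(1) by (meson card_2_iff)
  then show ?thesis using that assms(2) by simp
qed

text \<open>A shortest path from $s$ to $t$ avoiding the neighbours of $v$ closes up to a hole
  through $v$.\<close>

lemma hole_of_avoiding_path: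
  assumes edges: "\<And>e. e \<in> E \<Longrightarrow> card e = 2"
    and vs: "{v, s} \<in> E" and vt: "{v, t} \<in> E"
    and st: "s \<noteq> t" "{s, t} \<notin> E"
    and D: "\<And>d. d \<in> D \<Longrightarrow> d \<noteq> v \<and> {v, d} \<notin> E"
    and p: "p \<noteq> []" "hd p = s" "last p = t" "successively (\<lambda>a b. {a, b} \<in> E) p"
      "set p \<subseteq> insert s (insert t D)"
  shows "\<exists>xs. is_hole E xs"
proof -
  let ?r = "\<lambda>a b. {a, b} \<in> E"
  let ?P = "\<lambda>p. p \<noteq> [] \<and> hd p = s \<and> last p = t \<and> successively ?r p
              \<and> set p \<subseteq> insert s (insert t D)"
  \<comment> \<open>The minimum is taken only over walks in \<open>s\<close>, \<open>t\<close> and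
    \<open>D\<close>: other neighbours of \<open>v\<close> have to stay off the path.\<close>
  obtain xs where xs: "?P xs" and least: "\<And>ys. ?P ys \<Longrightarrow> length xs \<le> length ys"
    using ex_has_least_nat[of ?P p length] p by blast
  have noloop: "{a, a} \<notin> E" for a
    using edges[of "{a, a}"] by auto
  have shortest: "length xs \<le> length ys" if "ys \<noteq> []" "hd ys = hd xs" "last ys = last xs"
    "successively ?r ys" "set ys \<subseteq> set xs" for ys
    using that xs by (intro least) auto
  have suc: "successively ?r xs" using xs by simp
  have neq: "xs ! i \<noteq> xs ! j" if "i < j" "j < length xs" for i j
    by (rule shortest_path_induced(1)[of ?r xs, OF suc _ that]) (rule shortest)
  have chordless: "j = Suc i" if "i < j" "j < length xs" "{xs ! i, xs ! j} \<in> E" for i j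
    by (rule shortest_path_induced(2)[of ?r xs, OF suc _ that]) (rule shortest)
  define n where "n = length xs"
  have n0: "xs ! 0 = s"
    using xs by (metis hd_conv_nth)
  have nl: "xs ! (n - 1) = t"
    using xs by (metis last_conv_nth n_def)
  \<comment> \<open>The ends are distinct and nonadjacent, so the path has an inner vertex; adding
    \<open>v\<close> gives a cycle of length at least 4.\<close>
  have n3: "3 \<le> n"
  proof (rule ccontr)
    assume "\<not> 3 \<le> n"
    moreover have "n \<noteq> 0" using xs by (auto simp: n_def)
    ultimately have "n = 1 \<or> n = 2" by auto
    then show False
    proof
      assume "n = 1" with n0 nl st show False by simp
    next
      assume "n = 2"
      with n0 nl have "xs ! 0 = s" "xs ! Suc 0 = t" by auto
      moreover have "{xs ! 0, xs ! Suc 0} \<in> E"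
        using suc \<open>n = 2\<close> by (simp add: successively_conv_nth n_def)
      ultimately show False using st by simp
    qed
  qed
  have "v \<noteq> s" "v \<noteq> t"
    using vs vt noloop[of v] by auto
  then have v_notin: "v \<notin> set xs"
    using xs D by blast
  have dist: "distinct xs"
    unfolding distinct_conv_nth
  proof (intro allI impI)
    fix i j assume "i < length xs" "j < length xs" "i \<noteq> j"
    then show "xs ! i \<noteq> xs ! j"
      using neq[of i j] neq[of j i] by (metis linorder_neqE_nat)
  qed
  let ?ys = "v # xs"
  have cyc_sub: "cycle_edges ?ys \<subseteq> E"
  proof
    fix e assume "e \<in> cycle_edges ?ys"
    then obtain i where i: "i < Suc n" and e: "e = {?ys ! i, ?ys ! (Suc i mod Suc n)}"
      by (auto simp: cycle_edges_def n_def)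
    \<comment> \<open>The edge from \<open>v\<close> to \<open>s\<close>, the closing edge from
      \<open>t\<close> back to \<open>v\<close> (where the index wraps to 0), and the edges of the
      path.\<close>
    consider "i = 0" | "i = n" | "0 < i" "i < n" using i by linarith
    then show "e \<in> E"
    proof cases
      case 1
      then show ?thesis using e n0 n3 vs by simp
    next
      case 2
      then have "e = {t, v}" using e nl n3 by (simp add: nth_Cons')
      then show ?thesis using vt by (simp add: insert_commute)
    next
      case 3
      then obtain k where k: "i = Suc k" by (cases i) auto
      then have "e = {xs ! k, xs ! Suc k}" using e 3 by simp
      then show ?thesis using suc 3 k by (simp add: successively_conv_nth n_def)
    qed
  qed
  have cyc_mem: "{?ys ! i, ?ys ! (Suc i mod Suc n)} \<in> cycle_edges ?ys" if "i < Suc n" for i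
    using that by (auto simp: cycle_edges_def n_def)
  \<comment> \<open>No chords: an edge at \<open>v\<close> can only lead to \<open>s\<close> or
    \<open>t\<close>, since \<open>v\<close> has no neighbour in \<open>D\<close>, and two path
    vertices are adjacent only if consecutive.\<close>
  have key: "{?ys ! i, ?ys ! j} \<in> cycle_edges ?ys"
    if ij: "i < j" "j < Suc n" "{?ys ! i, ?ys ! j} \<in> E" for i j
  proof (cases i)
    case 0
    obtain k where k: "j = Suc k" "k < n" using ij by (cases j) auto
    have "{v, xs ! k} \<in> E" using ij 0 k by simp
    moreover have "xs ! k \<in> insert s (insert t D)"
      using xs k nth_mem[of k xs] unfolding n_def by blast
    ultimately have "xs ! k = s \<or> xs ! k = t" using D by auto
    then show ?thesis
    proof
      assume "xs ! k = s"
      then show ?thesis using cyc_mem[of 0] 0 k n0 n3 by simp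
    next
      assume "xs ! k = t"
      then show ?thesis using cyc_mem[of n] 0 k nl n3 by (simp add: nth_Cons' insert_commute)
    qed
  next
    case (Suc i')
    obtain k where k: "j = Suc k" "k < n" using ij by (cases j) auto
    have "k = Suc i'"
      using ij Suc k by (intro chordless) (auto simp: n_def)
    then show ?thesis using cyc_mem[of i] Suc k by simp
  qed
  have "induced_edges E (set ?ys) \<subseteq> cycle_edges ?ys"
  proof
    fix e assume "e \<in> induced_edges E (set ?ys)"
    then have eE: "e \<in> E" and "e \<subseteq> set ?ys" by (auto simp: induced_edges_def)
    then obtain a b where e: "e = {a, b}" "a \<noteq> b" "a \<in> set ?ys" "b \<in> set ?ys"
      using card_2_doubletonE edges by metis
    obtain i where i: "i < Suc n" "a = ?ys ! i"
      using e(3) by (metis in_set_conv_nth length_Cons n_def)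
    obtain j where j: "j < Suc n" "b = ?ys ! j"
      using e(4) by (metis in_set_conv_nth length_Cons n_def)
    have "i \<noteq> j" using e i j by auto
    then consider "i < j" | "j < i" by linarith
    then show "e \<in> cycle_edges ?ys"
    proof cases
      case 1
      then show ?thesis using key[of i j] e i j eE by simp
    next
      case 2
      then show ?thesis using key[of j i] e i j eE by (simp add: insert_commute)
    qed
  qed
  moreover have "cycle_edges ?ys \<subseteq> induced_edges E (set ?ys)"
  proof
    fix e assume e: "e \<in> cycle_edges ?ys"
    then obtain i where "i < Suc n" "e = {?ys ! i, ?ys ! (Suc i mod Suc n)}"
      by (auto simp: cycle_edges_def n_def)
    moreover have "?ys ! k \<in> set ?ys" if "k < Suc n" for k
      using nth_mem[of k ?ys] that by (simp add: n_def)
    ultimately have "e \<subseteq> set ?ys" by simp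
    then show "e \<in> induced_edges E (set ?ys)"
      using e cyc_sub by (auto simp: induced_edges_def)
  qed
  ultimately have "is_hole E ?ys"
    using cyc_sub dist v_notin n3 by (auto simp: is_hole_def is_cycle_def n_def)
  then show ?thesis by blast
qed

section \<open>Existence of simplicial vertices\<close>

text \<open>A form of Dirac's theorem that places the simplicial vertex away from \<open>v\<close>,
  which makes the induction work. Let \<open>C\<close> be the component of \<open>u\<close> among
  the non-neighbours \<open>D\<close> of \<open>v\<close>, and \<open>S\<close> the set of vertices
  outside \<open>C\<close> with a neighbour in \<open>C\<close>. Then \<open>S\<close> is a clique,
  since a nonadjacent pair would yield a hole through \<open>C\<close> and \<open>v\<close>. Either
  \<open>C \<union> S\<close> is a clique and \<open>u\<close> will do, or induction on
  \<open>C \<union> S\<close> finds a simplicial vertex in \<open>C\<close>.\<close>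

lemma chordal_simplicial_nonneighbour:
  assumes edges: "\<And>e. e \<in> E \<Longrightarrow> card e = 2"
    and chordal: "chordal E"
    and "finite U" "v \<in> U" "u \<in> U" "u \<noteq> v" "{v, u} \<notin> E"
  shows "\<exists>w\<in>U. w \<noteq> v \<and> {v, w} \<notin> E \<and> clique U E {a \<in> U. {a, w} \<in> E}"
  using assms(3-)
proof (induction U arbitrary: v u rule: finite_psubset_induct)
  case (psubset U)
  have noloop: "{a, a} \<notin> E" for a
    using edges[of "{a, a}"] by auto
  define D where "D = {a \<in> U. a \<noteq> v \<and> {v, a} \<notin> E}"
  define R where "R = {(a, b). {a, b} \<in> E \<and> a \<in> D \<and> b \<in> D}"
  define C where "C = {c. (u, c) \<in> R\<^sup>*}"
  define S where "S = {s \<in> U. s \<notin> C \<and> (\<exists>c\<in>C. {s, c} \<in> E)}"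
  have uD: "u \<in> D" using psubset.prems by (simp add: D_def)
  have uC: "u \<in> C" by (simp add: C_def)
  have C_sub: "C \<subseteq> D"
  proof
    fix c assume "c \<in> C"
    then have "(u, c) \<in> R\<^sup>*" by (simp add: C_def)
    then show "c \<in> D" by (induction) (use uD in \<open>auto simp: R_def\<close>)
  qed
  have symR: "sym (R\<^sup>*)"
    by (intro sym_rtrancl symI) (auto simp: R_def insert_commute)
  have closed: "a \<in> C \<union> S" if "a \<in> U" "c \<in> C" "{a, c} \<in> E" for a c
    using that by (auto simp: S_def)
  \<comment> \<open>A vertex adjacent to \<open>C\<close> but not to \<open>v\<close> would lie in
    \<open>D\<close> and hence in the component \<open>C\<close> itself.\<close>
  have S_nbr: "{v, s} \<in> E" if s: "s \<in> S" for s
  proof (rule ccontr)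
    assume nE: "{v, s} \<notin> E"
    from s obtain c where c: "c \<in> C" "{s, c} \<in> E" "s \<in> U" "s \<notin> C" by (auto simp: S_def)
    have "c \<in> D" using c C_sub by auto
    then have "s \<noteq> v" using c by (auto simp: D_def)
    then have "s \<in> D" using c nE by (simp add: D_def)
    then have "(c, s) \<in> R" using c \<open>c \<in> D\<close> by (simp add: R_def insert_commute)
    then have "s \<in> C" using c by (auto simp: C_def intro: rtrancl_into_rtrancl)
    with c show False by simp
  qed
  have S_clique: "{s, t} \<in> E" if st: "s \<in> S" "t \<in> S" "s \<noteq> t" for s t
  proof (rule ccontr)
    assume nE: "{s, t} \<notin> E"
    obtain c where c: "c \<in> C" "{s, c} \<in> E" using st by (auto simp: S_def)
    obtain d where d: "d \<in> C" "{t, d} \<in> E" using st by (auto simp: S_def)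
    have "(c, u) \<in> R\<^sup>*" "(u, d) \<in> R\<^sup>*"
      using c d symR by (auto simp: C_def dest: symD)
    then have cd: "(c, d) \<in> R\<^sup>*" by (rule rtrancl_trans)
    \<comment> \<open>A path inside \<open>D\<close> between a neighbour of \<open>s\<close> and a
      neighbour of \<open>t\<close>; putting \<open>s\<close> and \<open>t\<close> at its ends gives
      the path that \<open>v\<close> closes to a hole.\<close>
    obtain p where p: "p \<noteq> []" "hd p = c" "last p = d" "successively (\<lambda>x y. (x, y) \<in> R) p"
      using rtrancl_imp_successively[OF cd] by blast
    have pD: "set p \<subseteq> D"
    proof
      fix z assume "z \<in> set p"
      then obtain i where i: "i < length p" "z = p ! i" by (auto simp: in_set_conv_nth)
      show "z \<in> D"
      proof (cases i)
        case 0
        then have "z = c" using i p by (metis hd_conv_nth)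
        then show ?thesis using c C_sub by auto
      next
        case (Suc k)
        then have "(p ! k, p ! Suc k) \<in> R" using p(4) i by (simp add: successively_conv_nth)
        then show ?thesis using i Suc by (simp add: R_def)
      qed
    qed
    have "successively (\<lambda>a b. {a, b} \<in> E) p"
      using p(4) by (rule successively_mono) (auto simp: R_def)
    then have "successively (\<lambda>a b. {a, b} \<in> E) (s # p @ [t])"
      using p c d
      by (auto simp: successively_append_iff successively_Cons insert_commute)
    then have "\<exists>xs. is_hole E xs"
      using st nE pD S_nbr
      by (intro hole_of_avoiding_path[of E v s t D "s # p @ [t]"] edges)
         (auto simp: D_def)
    with chordal show False by (simp add: chordal_def)
  qed
  define H where "H = C \<union> S"
  have vH: "v \<notin> H"
    using C_sub noloop[of v] S_nbr[of v] by (auto simp: H_def D_def)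
  have HU: "H \<subset> U"
    using C_sub vH psubset.prems(1) by (auto simp: H_def S_def D_def)
  \<comment> \<open>All neighbours in \<open>U\<close> of a vertex of \<open>C\<close> lie in
    \<open>H\<close>, so a vertex of \<open>C\<close> that is simplicial in \<open>H\<close> is
    simplicial in \<open>U\<close>.\<close>
  have lift: "\<exists>w\<in>U. w \<noteq> v \<and> {v, w} \<notin> E \<and> clique U E {a \<in> U. {a, w} \<in> E}"
    if w: "w \<in> C" "clique H E {a \<in> H. {a, w} \<in> E}" for w
  proof -
    have "{a \<in> U. {a, w} \<in> E} = {a \<in> H. {a, w} \<in> E}"
      using closed w HU by (auto simp: H_def)
    then have "clique U E {a \<in> U. {a, w} \<in> E}"
      using w(2) HU by (auto simp: clique_def)
    moreover have "w \<in> D" using w C_sub by auto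
    ultimately show ?thesis by (auto simp: D_def)
  qed
  show ?case
  proof (cases "clique H E H")
    case True
    then have "clique H E {a \<in> H. {a, u} \<in> E}" by (auto simp: clique_def)
    then show ?thesis using lift uC by blast
  next
    case False
    show ?thesis
    proof (cases "\<exists>s\<in>S. \<exists>z\<in>H. z \<noteq> s \<and> {s, z} \<notin> E")
      case True
      \<comment> \<open>Induction with \<open>s\<close> in the role of \<open>v\<close>: the vertex
        found is not adjacent to \<open>s\<close>, so it lies outside the clique
        \<open>S\<close>.\<close>
      then obtain s z where sz: "s \<in> S" "z \<in> H" "z \<noteq> s" "{s, z} \<notin> E" by blast
      then obtain w where w: "w \<in> H" "w \<noteq> s" "{s, w} \<notin> E" "clique H E {a \<in> H. {a, w} \<in> E}"
        using psubset.IH[OF HU, of s z] by (auto simp: H_def)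
      then have "w \<in> C" using S_clique sz by (auto simp: H_def)
      then show ?thesis using lift w by blast
    next
      case dom: False
      \<comment> \<open>Now every vertex of \<open>S\<close> is adjacent to all others of
        \<open>H\<close>, so the vertex found, which misses \<open>s\<close>, again lies in
        \<open>C\<close>.\<close>
      obtain s z where sz: "s \<in> H" "z \<in> H" "z \<noteq> s" "{s, z} \<notin> E"
        using False by (auto simp: clique_def)
      then obtain w where w: "w \<in> H" "w \<noteq> s" "{s, w} \<notin> E" "clique H E {a \<in> H. {a, w} \<in> E}"
        using psubset.IH[OF HU, of s z] by auto
      then have "{w, s} \<notin> E" by (simp add: insert_commute)
      then have "w \<notin> S" using dom w(2) sz(1) by metis
      then have "w \<in> C" using w(1) by (simp add: H_def)
      then show ?thesis using lift w by blast
    qed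
  qed
qed

lemma chordal_simplicial_vertex:
  assumes edges: "\<And>e. e \<in> E \<Longrightarrow> card e = 2"
    and "chordal E" "finite U" "U \<noteq> {}"
  obtains w where "w \<in> U" "clique U E {a \<in> U. {a, w} \<in> E}"
proof (cases "clique U E U")
  case True
  then show ?thesis using that assms(4) by (fastforce simp: clique_def)
next
  case False
  then obtain v u where "v \<in> U" "u \<in> U" "u \<noteq> v" "{v, u} \<notin> E"
    by (auto simp: clique_def)
  then show ?thesis
    using chordal_simplicial_nonneighbour[OF edges assms(2,3)] that by blast
qed

section \<open>Induced trees\<close>

lemma triangle_is_cycle:
  assumes "a \<noteq> b" "a \<noteq> c" "b \<noteq> c" "{a, b} \<in> F" "{b, c} \<in> F" "{a, c} \<in> F"
  shows "is_cycle F [a, b, c]"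
proof -
  have "{c, a} \<in> F" using assms by (simp add: insert_commute)
  have "cycle_edges [a, b, c] \<subseteq> F"
  proof
    have len: "length [a, b, c] = 3" by simp
    fix e assume "e \<in> cycle_edges [a, b, c]"
    then obtain i where i: "i < 3" and e: "e = {[a, b, c] ! i, [a, b, c] ! (Suc i mod 3)}"
      unfolding cycle_edges_def len by blast
    have "i = 0 \<or> i = 1 \<or> i = 2" using i by auto
    then show "e \<in> F"
      using assms(4,5) \<open>{c, a} \<in> F\<close> by (elim disjE) (simp_all add: e)
  qed
  then show ?thesis
    using assms by (simp add: is_cycle_def)
qed

text \<open>The cyclic successor (index \<open>j\<close>) and predecessor (index \<open>k\<close>)
  of \<open>x\<close> are distinct because the length is at least 3. This is what keeps cycles away
  from leaves.\<close>

lemma cycle_two_neighbours: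
  assumes cyc: "is_cycle F xs" and x: "x \<in> set xs"
  obtains a b where "a \<noteq> b" "a \<noteq> x" "b \<noteq> x" "{a, x} \<in> F" "{b, x} \<in> F"
proof -
  define n where "n = length xs"
  have n: "3 \<le> n" "distinct xs" and sub: "cycle_edges xs \<subseteq> F"
    using cyc by (auto simp: is_cycle_def n_def)
  have edge: "{xs ! i, xs ! (Suc i mod n)} \<in> F" if "i < n" for i
    using sub that by (auto simp: cycle_edges_def n_def)
  obtain i where i: "i < n" "x = xs ! i" using x by (metis in_set_conv_nth n_def)
  define j where "j = (if Suc i = n then 0 else Suc i)"
  define k where "k = (if i = 0 then n - 1 else i - 1)"
  have jk: "j < n" "k < n" "j \<noteq> k" "j \<noteq> i" "k \<noteq> i"
    using i n by (auto simp: j_def k_def)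
  have "Suc i mod n = j" "Suc k mod n = i"
    using i n by (auto simp: j_def k_def)
  then have "{xs ! j, x} \<in> F" "{xs ! k, x} \<in> F"
    using edge[of i] edge[of k] i jk by (auto simp: insert_commute)
  moreover have "xs ! j \<noteq> xs ! k" "xs ! j \<noteq> x" "xs ! k \<noteq> x"
    using n i jk by (auto simp: nth_eq_iff_index_eq n_def)
  ultimately show ?thesis using that by blast
qed

lemma cycle_vertices_subset:
  assumes "is_cycle (induced_edges E W) xs"
  shows "set xs \<subseteq> W"
proof
  fix v assume "v \<in> set xs"
  with assms obtain a where "{a, v} \<in> induced_edges E W"
    by (rule cycle_two_neighbours)
  then show "v \<in> W" by (simp add: induced_edges_def)
qed

lemma induced_tree_singleton:
  assumes "v \<in> V"
  shows "induced_tree V E {v}"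
proof -
  have "\<not> is_cycle (induced_edges E {v}) xs" for xs
  proof
    assume cyc: "is_cycle (induced_edges E {v}) xs"
    then have "card (set xs) \<le> card {v}"
      by (intro card_mono cycle_vertices_subset) auto
    with cyc show False by (simp add: is_cycle_def distinct_card)
  qed
  then show ?thesis
    using assms by (auto simp: induced_tree_def connected_graph_def acyclic_graph_def)
qed

text \<open>Attaching a leaf: all vertices stay connected through \<open>u\<close>, and no cycle
  passes through \<open>v\<close>, because it would need two neighbours of \<open>v\<close>.\<close>

lemma induced_tree_insert:
  assumes tree: "induced_tree V E T" and v: "v \<in> V"
    and leaf: "\<And>a. a \<in> T \<Longrightarrow> {a, v} \<in> E \<longleftrightarrow> a = u" and u: "u \<in> T"
  shows "induced_tree V E (insert v T)"
proof -
  let ?F = "induced_edges E T" and ?F' = "induced_edges E (insert v T)"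
  let ?R = "{(a, b). {a, b} \<in> ?F}" and ?R' = "{(a, b). {a, b} \<in> ?F'}"
  have "?R \<subseteq> ?R'" by (auto simp: induced_edges_def)
  then have "?R\<^sup>* \<subseteq> ?R'\<^sup>*" by (rule rtrancl_mono)
  moreover have "(a, u) \<in> ?R\<^sup>*" "(u, a) \<in> ?R\<^sup>*" if "a \<in> T" for a
    using tree that u by (auto simp: induced_tree_def connected_graph_def)
  moreover have "(u, v) \<in> ?R'" "(v, u) \<in> ?R'"
    using leaf u by (auto simp: induced_edges_def insert_commute)
  ultimately have hub: "(a, u) \<in> ?R'\<^sup>*" "(u, a) \<in> ?R'\<^sup>*" if "a \<in> insert v T" for a
    using that by blast+
  then have conn: "connected_graph (insert v T) ?F'"
    by (auto simp: connected_graph_def intro: rtrancl_trans[OF hub(1) hub(2)])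
  have "\<not> is_cycle ?F' xs" for xs
  proof
    assume cyc: "is_cycle ?F' xs"
    have "v \<notin> set xs"
    proof
      assume "v \<in> set xs"
      with cyc obtain a b where ab: "a \<noteq> b" "a \<noteq> v" "b \<noteq> v" "{a, v} \<in> ?F'" "{b, v} \<in> ?F'"
        by (rule cycle_two_neighbours)
      then have "a = u" "b = u"
        using leaf by (auto simp: induced_edges_def)
      with ab show False by simp
    qed
    moreover have "e \<subseteq> set xs" if "e \<in> cycle_edges xs" for e
      using that by (auto simp: cycle_edges_def intro!: nth_mem mod_less_divisor)
    ultimately have "cycle_edges xs \<subseteq> ?F"
      using cyc by (fastforce simp: is_cycle_def induced_edges_def)
    then have "is_cycle ?F xs" using cyc by (simp add: is_cycle_def)
    with tree show False by (auto simp: induced_tree_def acyclic_graph_def)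
  qed
  then show ?thesis
    using conn tree v by (auto simp: induced_tree_def acyclic_graph_def)
qed

section \<open>Incidence vectors of trees lie in the cone\<close>

text \<open>Two edges of the tree at \<open>v\<close> with their other ends in a common clique would
  span a triangle, so the left side of each clique inequality is at most 1, and it is 0 when
  \<open>v\<close> is not in the tree.\<close>

lemma extended_incidence_in_tree_cone:
  assumes G: "simple_graph V E" and tree: "induced_tree V E W"
  shows "extended_incidence E W \<in> tree_cone V E"
proof -
  interpret simple_graph V E by (rule G)
  let ?F = "induced_edges E W"
  have W: "W \<subseteq> V" and acyclic: "\<And>xs. \<not> is_cycle ?F xs"
    using tree by (auto simp: induced_tree_def acyclic_graph_def)
  have "(\<Sum>u\<in>K - {v}. indicator ?F {u, v}) \<le> (indicator W v :: real)"
    if K: "K \<in> maximal_cliques_at V E v" for v K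
  proof -
    have clq: "clique V E K" and vK: "v \<in> K" using K by (auto simp: maximal_cliques_at_def)
    then have finK: "finite K" using finite_vertices by (auto simp: clique_def intro: finite_subset)
    define B where "B = {u \<in> K - {v}. {u, v} \<in> ?F}"
    have "finite B" using finK by (simp add: B_def)
    have "(\<Sum>u\<in>K - {v}. indicator ?F {u, v}) = (\<Sum>u\<in>B. 1 :: real)"
      using finK by (intro sum.mono_neutral_cong_right) (auto simp: B_def indicator_def)
    also have "\<dots> = real (card B)" by simp
    also have "\<dots> \<le> indicator W v"
    proof (cases "v \<in> W")
      case True
      have "a = b" if "a \<in> B" "b \<in> B" for a b
      proof (rule ccontr)
        assume "a \<noteq> b"
        moreover have "{a, b} \<in> ?F"
          using that clq \<open>a \<noteq> b\<close> by (auto simp: B_def clique_def induced_edges_def)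
        ultimately have "is_cycle ?F [a, b, v]"
          using that by (intro triangle_is_cycle) (auto simp: B_def)
        with acyclic show False by blast
      qed
      then have "card B \<le> Suc 0" using \<open>finite B\<close> by (simp add: card_le_Suc0_iff_eq)
      then show ?thesis using True by simp
    next
      case False
      then have "B = {}" by (auto simp: B_def induced_edges_def)
      then show ?thesis by simp
    qed
    finally show ?thesis .
  qed
  moreover have "?F \<subseteq> E" by (auto simp: induced_edges_def)
  ultimately show ?thesis
    using W by (auto simp: extended_incidence_def tree_cone_def indicator_def)
qed

section \<open>Decomposition of integer points\<close>

text \<open>The inequalities are required for all cliques, because a maximal clique of a smaller
  vertex set need not be maximal in the larger one. The combination is an indexed family in which a
  tree may repeat, so that \<open>v\<close> can be attached to some copies of a tree and not to
  others.\<close>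

lemma tree_decomposition:
  fixes x :: "'a \<Rightarrow> nat" and y :: "'a set \<Rightarrow> nat"
  assumes card_2: "\<forall>e\<in>E. card e = 2"
    and chordal: "chordal E" and "finite U"
    and "\<forall>v K. clique U E K \<longrightarrow> v \<in> K \<longrightarrow> (\<Sum>u\<in>K - {v}. y {u, v}) \<le> x v"
  shows "\<exists>m T. (\<forall>i<m. induced_tree U E (T i))
    \<and> (\<forall>v\<in>U. card {i. i < m \<and> v \<in> T i} = x v)
    \<and> (\<forall>e\<in>E. e \<subseteq> U \<longrightarrow> card {i. i < (m :: nat) \<and> e \<subseteq> T i} = y e)"
  using assms(3-)
proof (induction U rule: finite_psubset_induct)
  case (psubset U)
  note edges = card_2[rule_format] and clique_le = psubset.prems[rule_format]
  show ?case
  proof (cases "U = {}")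
    case True
    have "e \<noteq> {}" if "e \<in> E" for e using edges[OF that] by auto
    with True show ?thesis by (intro exI[of _ 0]) auto
  next
    case False
    have noloop: "{a, a} \<notin> E" for a
      using edges[of "{a, a}"] by auto
    obtain v where v: "v \<in> U" and simplicial: "clique U E {a \<in> U. {a, v} \<in> E}"
      using chordal_simplicial_vertex[OF edges chordal psubset.hyps False] by blast
    define N where "N = {a \<in> U. {a, v} \<in> E}"
    define U' where "U' = U - {v}"
    have finN: "finite N" using psubset.hyps by (simp add: N_def)
    have vN: "v \<notin> N" using noloop by (simp add: N_def)
    have N_clique: "clique U E (insert v N)"
      using simplicial v by (auto simp: clique_def N_def insert_commute)
    have U'_less: "U' \<subset> U" using v by (auto simp: U'_def)
    have "clique U E K" if "clique U' E K" for K
      using that by (auto simp: clique_def U'_def)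
    then have U'_le: "\<forall>v K. clique U' E K \<longrightarrow> v \<in> K \<longrightarrow> (\<Sum>u\<in>K - {v}. y {u, v}) \<le> x v"
      using psubset.prems by blast
    obtain m T where "\<forall>i<m. induced_tree U' E (T i)"
      and "\<forall>w\<in>U'. card {i. i < m \<and> w \<in> T i} = x w"
      and "\<forall>e\<in>E. e \<subseteq> U' \<longrightarrow> card {i. i < (m :: nat) \<and> e \<subseteq> T i} = y e"
      using psubset.IH[OF U'_less U'_le] by (elim exE conjE) (rule that)
    note tree = this(1)[rule_format] and x = this(2)[rule_format] and y = this(3)[rule_format]
    \<comment> \<open>The trees to which \<open>v\<close> can be attached with \<open>u\<close> as
      its only neighbour.\<close>
    define J where "J u = {i. i < m \<and> T i \<inter> N = {u}}" for u
    have finJ: "finite (J u)" for u by (simp add: J_def)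
    have "y {u, v} \<le> card (J u)" if u: "u \<in> N" for u
    proof -
      have uU: "u \<in> U'" using u vN by (auto simp: N_def U'_def)
      \<comment> \<open>A tree that contains \<open>u\<close> but is not counted by
        \<open>J u\<close> contains a further \<open>w\<close> in \<open>N\<close>, and
        \<open>{w, u}\<close> is an edge since \<open>N\<close> is a clique. Counting these trees by
        \<open>y\<close> bounds \<open>x u\<close>, to be compared with the inequality of
        \<open>u\<close> for \<open>insert v N\<close>.\<close>
      have "{i. i < m \<and> u \<in> T i} \<subseteq> J u \<union> (\<Union>w\<in>N - {u}. {i. i < m \<and> {w, u} \<subseteq> T i})"
        using u by (auto simp: J_def)
      then have "x u \<le> card (J u \<union> (\<Union>w\<in>N - {u}. {i. i < m \<and> {w, u} \<subseteq> T i}))"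
        unfolding x[OF uU, symmetric] using finN by (intro card_mono) (auto simp: J_def)
      also have "\<dots> \<le> card (J u) + card (\<Union>w\<in>N - {u}. {i. i < m \<and> {w, u} \<subseteq> T i})"
        by (rule card_Un_le)
      also have "\<dots> \<le> card (J u) + (\<Sum>w\<in>N - {u}. card {i. i < m \<and> {w, u} \<subseteq> T i})"
        using finN by (intro add_left_mono card_UN_le) auto
      also have "(\<Sum>w\<in>N - {u}. card {i. i < m \<and> {w, u} \<subseteq> T i}) = (\<Sum>w\<in>N - {u}. y {w, u})"
      proof (rule sum.cong[OF refl])
        fix w assume w: "w \<in> N - {u}"
        then have "{w, u} \<in> E" using N_clique u by (auto simp: clique_def)
        moreover have "{w, u} \<subseteq> U'" using w u vN by (auto simp: N_def U'_def)
        ultimately show "card {i. i < m \<and> {w, u} \<subseteq> T i} = y {w, u}" by (rule y)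
      qed
      finally have "x u \<le> card (J u) + (\<Sum>w\<in>N - {u}. y {w, u})" .
      moreover have "insert v N - {u} = insert v (N - {u})" using u vN by auto
      then have "y {v, u} + (\<Sum>w\<in>N - {u}. y {w, u}) \<le> x u"
        using clique_le[OF N_clique, of u] u vN finN by simp
      ultimately show ?thesis by (simp add: insert_commute)
    qed
    then have "\<forall>u\<in>N. \<exists>A. A \<subseteq> J u \<and> card A = y {u, v}"
      using finJ by (meson obtain_subset_with_card_n)
    then obtain A where A: "\<And>u. u \<in> N \<Longrightarrow> A u \<subseteq> J u" "\<And>u. u \<in> N \<Longrightarrow> card (A u) = y {u, v}"
      by metis
    have A_meet: "i < m" "T i \<inter> N = {u}" if "u \<in> N" "i \<in> A u" for i u
      using A(1)[OF that(1)] that(2) by (auto simp: J_def)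
    define B where "B = (\<Union>u\<in>N. A u)"
    \<comment> \<open>Indices in \<open>B\<close> receive \<open>v\<close>, other indices below
      \<open>m\<close> keep their tree, and indices from \<open>m\<close> on are copies of the
      single vertex.\<close>
    define T' where "T' i = (if i < m then if i \<in> B then insert v (T i) else T i else {v})" for i
    have B_m: "i < m" if "i \<in> B" for i
      using that A_meet(1) by (auto simp: B_def)
    have finB: "finite B"
      by (rule finite_subset[of _ "{..<m}"]) (use B_m in auto)
    \<comment> \<open>The sets \<open>A u\<close> are disjoint, since a tree chosen for
      \<open>u\<close> meets \<open>N\<close> in \<open>u\<close> alone.\<close>
    have "card B = (\<Sum>u\<in>N. card (A u))"
      unfolding B_def
    proof (rule card_UN_disjoint[OF finN])
      show "\<forall>u\<in>N. finite (A u)" using A finJ finite_subset by metis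
      show "\<forall>u\<in>N. \<forall>w\<in>N. u \<noteq> w \<longrightarrow> A u \<inter> A w = {}"
      proof (intro ballI impI, rule ccontr)
        fix u w assume uw: "u \<in> N" "w \<in> N" "u \<noteq> w" and "A u \<inter> A w \<noteq> {}"
        then obtain i where "i \<in> A u" "i \<in> A w" by blast
        then have "{u} = {w}" using A_meet(2)[of u i] A_meet(2)[of w i] uw by simp
        with uw show False by simp
      qed
    qed
    also have "\<dots> = (\<Sum>u\<in>insert v N - {v}. y {u, v})"
      using A vN by simp
    also have "\<dots> \<le> x v"
      by (rule clique_le[OF N_clique]) simp
    finally have Bx: "card B \<le> x v" .
    \<comment> \<open>The number of single vertices still needed to cover \<open>v\<close> exactly
      \<open>x v\<close> times; by \<open>Bx\<close> the subtraction does not truncate.\<close>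
    define r where "r = x v - card B"
    have TU: "T i \<subseteq> U'" if "i < m" for i
      using tree[OF that] by (simp add: induced_tree_def)
    then have vT: "v \<notin> T i" if "i < m" for i
      using that by (auto simp: U'_def)
    have "induced_tree U E (T' i)" if "i < m + r" for i
    proof (cases "i < m")
      case im: True
      have treeU: "induced_tree U E (T i)"
        using tree[OF im] by (auto simp: induced_tree_def U'_def)
      show ?thesis
      proof (cases "i \<in> B")
        case True
        then obtain u where "u \<in> N" "i \<in> A u" by (auto simp: B_def)
        then have u: "T i \<inter> N = {u}" by (rule A_meet)
        have "induced_tree U E (insert v (T i))"
        proof (rule induced_tree_insert[OF treeU v, of u])
          show "{a, v} \<in> E \<longleftrightarrow> a = u" if "a \<in> T i" for a
            using u that TU[OF im] by (auto simp: N_def U'_def)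
        qed (use u in auto)
        then show ?thesis using im True by (simp add: T'_def)
      next
        case False
        then show ?thesis using im treeU by (simp add: T'_def)
      qed
    next
      case False
      then show ?thesis using induced_tree_singleton[OF v] by (simp add: T'_def)
    qed
    moreover have "card {i. i < m + r \<and> w \<in> T' i} = x w" if w: "w \<in> U" for w
    proof (cases "w = v")
      case True
      have "{i. i < m + r \<and> v \<in> T' i} = B \<union> {m..<m + r}"
        using B_m vT by (auto simp: T'_def trans_less_add1)
      moreover have "card (B \<union> {m..<m + r}) = card B + r"
        using finB B_m by (subst card_Un_disjoint) fastforce+
      ultimately show ?thesis using True Bx by (simp add: r_def)
    next
      case False
      then have "{i. i < m + r \<and> w \<in> T' i} = {i. i < m \<and> w \<in> T i}"
        by (auto simp: T'_def split: if_splits)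
      then show ?thesis using x w False by (simp add: U'_def)
    qed
    moreover have "card {i. i < m + r \<and> e \<subseteq> T' i} = y e" if e: "e \<in> E" "e \<subseteq> U" for e
    proof (cases "v \<in> e")
      case True
      then obtain u where u: "e = {u, v}" "u \<noteq> v"
        using edges[OF e(1)] by (auto simp: card_2_iff)
      then have uN: "u \<in> N" using e by (auto simp: N_def)
      \<comment> \<open>A tree extended on account of some \<open>w\<close> meets \<open>N\<close>
        only in \<open>w\<close>, so the edge \<open>{u, v}\<close> arises only from the indices in
        \<open>A u\<close>.\<close>
      have "i \<in> A u" if "i \<in> B" "u \<in> T i" for i
      proof -
        obtain w where w: "w \<in> N" "i \<in> A w" using \<open>i \<in> B\<close> by (auto simp: B_def)
        then have "T i \<inter> N = {w}" by (rule A_meet)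
        then have "u = w" using that uN by auto
        with w show ?thesis by simp
      qed
      moreover have "i \<in> B" "u \<in> T i" if "i \<in> A u" for i
        using that uN A_meet[OF uN that] by (auto simp: B_def)
      moreover have "i < m + r \<and> e \<subseteq> T' i \<longleftrightarrow> i \<in> B \<and> u \<in> T i" for i
      proof (cases "i < m")
        case True
        then show ?thesis using u vT[OF True] by (simp add: T'_def)
      next
        case False
        then show ?thesis using u B_m[of i] by (auto simp: T'_def)
      qed
      ultimately have "{i. i < m + r \<and> e \<subseteq> T' i} = A u" by blast
      then show ?thesis using A uN u by simp
    next
      case False
      \<comment> \<open>An empty set would be contained in the added copies of \<open>{v}\<close>
        and spoil the count.\<close>
      have "e \<noteq> {}" using edges[OF e(1)] by auto
      with False have "{i. i < m + r \<and> e \<subseteq> T' i} = {i. i < m \<and> e \<subseteq> T i}"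
        by (auto simp: T'_def subset_insert subset_singleton_iff split: if_splits)
      then show ?thesis using y[OF e(1)] e False by (simp add: U'_def subset_Diff_insert)
    qed
    ultimately show ?thesis by blast
  qed
qed

section \<open>From the cone to the combinatorial decomposition\<close>

lemma clique_extends_to_maximal:
  assumes "finite V" "clique V E K" "v \<in> K"
  obtains K' where "K \<subseteq> K'" "K' \<in> maximal_cliques_at V E v"
proof -
  have "finite {K. clique V E K}"
    by (rule finite_subset[of _ "Pow V"]) (use assms(1) in \<open>auto simp: clique_def\<close>)
  then obtain K' where K': "clique V E K'" "K \<subseteq> K'"
    and max: "\<And>L. clique V E L \<Longrightarrow> K' \<subseteq> L \<Longrightarrow> L = K'"
    using finite_has_maximal2[of "{K. clique V E K}" K] assms(2) by auto
  then have "K' \<in> maximal_cliques_at V E v"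
    using assms(3) by (auto simp: maximal_cliques_at_def)
  with K'(2) that show ?thesis by blast
qed

text \<open>Enlarging \<open>K\<close> to a maximal clique only adds nonnegative terms to the sum.
  This supplies the inequalities for all cliques on which the induction rests.\<close>

lemma tree_cone_clique_le:
  assumes G: "simple_graph V E" and p: "(x, y) \<in> tree_cone V E"
    and K: "clique V E K" "v \<in> K"
  shows "(\<Sum>u\<in>K - {v}. y {u, v}) \<le> x v"
proof -
  interpret simple_graph V E by (rule G)
  obtain K' where K': "K \<subseteq> K'" "K' \<in> maximal_cliques_at V E v"
    using clique_extends_to_maximal[OF finite_vertices K] by blast
  have clq: "clique V E K'" using K' by (simp add: maximal_cliques_at_def)
  have vV: "v \<in> V" using K by (auto simp: clique_def)
  have "(\<Sum>u\<in>K - {v}. y {u, v}) \<le> (\<Sum>u\<in>K' - {v}. y {u, v})"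
  proof (rule sum_mono2)
    show "finite (K' - {v})"
      using clq finite_vertices by (auto simp: clique_def intro: finite_subset)
    fix u assume "u \<in> K' - {v} - (K - {v})"
    then have "{u, v} \<in> E" using clq K' K by (auto simp: clique_def)
    then show "0 \<le> y {u, v}" using p by (simp add: tree_cone_def)
  qed (use K' in auto)
  also have "\<dots> \<le> x v" using p K' vV by (auto simp: tree_cone_def)
  finally show ?thesis .
qed

text \<open>Grouping equal members turns an indexed family into a combination over a set; the
  coefficient of \<open>s\<close> is the number of indices \<open>i\<close> with
  \<open>g i = s\<close>.\<close>

lemma nonneg_int_combination_family:
  assumes "finite I" "\<And>i. i \<in> I \<Longrightarrow> g i \<in> S"
  shows "nonneg_int_combination S (\<lambda>a. \<Sum>i\<in>I. fst (g i) a, \<lambda>b. \<Sum>i\<in>I. snd (g i) b)"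
proof -
  have "(\<Sum>i\<in>I. f (g i)) = (\<Sum>s\<in>g ` I. real (card {i \<in> I. g i = s}) * f s)"
    for f :: "('b \<Rightarrow> real) \<times> ('c \<Rightarrow> real) \<Rightarrow> real"
  proof -
    have "(\<Sum>i\<in>I. f (g i)) = (\<Sum>s\<in>g ` I. \<Sum>i\<in>{i \<in> I. g i = s}. f (g i))"
      by (rule sum.image_gen[OF assms(1)])
    then show ?thesis by simp
  qed
  from this[of "\<lambda>s. fst s _"] this[of "\<lambda>s. snd s _"] show ?thesis
    unfolding nonneg_int_combination_def
    using assms by (intro exI[of _ "g ` I"] exI[of _ "\<lambda>s. card {i \<in> I. g i = s}"]) auto
qed

theorem theorem1p1:
  fixes V :: "'a set" and E :: "'a set set"
  assumes "simple_graph V E" and "chordal E"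
  shows "hilbert_basis {extended_incidence E W | W. induced_tree V E W} (tree_cone V E)"
proof -
  interpret simple_graph V E by (rule assms(1))
  have card_2: "\<forall>e\<in>E. card e = 2" using edge_card by blast
  let ?S = "{extended_incidence E W | W. induced_tree V E W}"
  have "nonneg_int_combination ?S (x, y)"
    if cone: "(x, y) \<in> tree_cone V E" and int: "integer_point (x, y)" for x y
  proof -
    have x0: "x v = 0" if "v \<notin> V" for v using cone that by (simp add: tree_cone_def)
    have y0: "y e = 0" if "e \<notin> E" for e using cone that by (simp add: tree_cone_def)
    have "0 \<le> x v" for v using cone by (cases "v \<in> V") (auto simp: tree_cone_def)
    \<comment> \<open>Coordinates are nonnegative integers, so passing to natural numbers loses
      nothing.\<close>
    then have xn: "real (nat \<lfloor>x v\<rfloor>) = x v" for v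
      using int by (simp add: integer_point_def)
    have "0 \<le> y e" for e using cone by (cases "e \<in> E") (auto simp: tree_cone_def)
    then have yn: "real (nat \<lfloor>y e\<rfloor>) = y e" for e
      using int by (simp add: integer_point_def)
    have le: "\<forall>v K. clique V E K \<longrightarrow> v \<in> K \<longrightarrow> (\<Sum>u\<in>K - {v}. nat \<lfloor>y {u, v}\<rfloor>) \<le> nat \<lfloor>x v\<rfloor>"
    proof (intro allI impI)
      fix v K assume K: "clique V E K" "v \<in> K"
      have "real (\<Sum>u\<in>K - {v}. nat \<lfloor>y {u, v}\<rfloor>) \<le> real (nat \<lfloor>x v\<rfloor>)"
        using tree_cone_clique_le[OF assms(1) cone K] by (simp only: of_nat_sum xn yn)
      then show "(\<Sum>u\<in>K - {v}. nat \<lfloor>y {u, v}\<rfloor>) \<le> nat \<lfloor>x v\<rfloor>"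
        by (simp only: of_nat_le_iff)
    qed
    obtain m T where "\<forall>i<m. induced_tree V E (T i)"
      and "\<forall>v\<in>V. card {i. i < m \<and> v \<in> T i} = nat \<lfloor>x v\<rfloor>"
      and "\<forall>e\<in>E. e \<subseteq> V \<longrightarrow> card {i. i < (m :: nat) \<and> e \<subseteq> T i} = nat \<lfloor>y e\<rfloor>"
      using tree_decomposition[OF card_2 assms(2) finite_vertices le]
      by (elim exE conjE) (rule that)
    note tree = this(1)[rule_format] and x = this(2)[rule_format] and y = this(3)[rule_format]
    have TV: "T i \<subseteq> V" if "i < m" for i using tree[OF that] by (simp add: induced_tree_def)
    have "(\<Sum>i<m. indicator (T i) v) = x v" for v
    proof -
      have "(\<Sum>i<m. indicator (T i) v) = (\<Sum>i\<in>{i. i < m \<and> v \<in> T i}. 1 :: real)"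
        by (rule sum.mono_neutral_cong_right) auto
      then have "(\<Sum>i<m. indicator (T i) v) = real (card {i. i < m \<and> v \<in> T i})" by simp
      also have "\<dots> = x v"
      proof (cases "v \<in> V")
        case True
        then show ?thesis using x xn by simp
      next
        case False
        then have "{i. i < m \<and> v \<in> T i} = {}" using TV by auto
        then show ?thesis using x0 False by simp
      qed
      finally show ?thesis .
    qed
    moreover have "(\<Sum>i<m. indicator (induced_edges E (T i)) e) = y e" for e
    proof (cases "e \<in> E")
      case True
      \<comment> \<open>For an edge \<open>e\<close>, being induced by \<open>T i\<close> means
        \<open>e \<subseteq> T i\<close>, which is what the decomposition counts.\<close>
      have "(\<Sum>i<m. indicator (induced_edges E (T i)) e) = (\<Sum>i\<in>{i. i < m \<and> e \<subseteq> T i}. 1 :: real)"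
        using True by (intro sum.mono_neutral_cong_right) (auto simp: induced_edges_def)
      then show ?thesis using y[OF True edge_subset[OF True]] yn by simp
    next
      case False
      then show ?thesis using y0 by (simp add: induced_edges_def)
    qed
    ultimately have "(x, y) = (\<lambda>a. \<Sum>i<m. fst (extended_incidence E (T i)) a,
                               \<lambda>b. \<Sum>i<m. snd (extended_incidence E (T i)) b)"
      by (simp add: extended_incidence_def)
    then show ?thesis
      using tree nonneg_int_combination_family[of "{..<m}" "\<lambda>i. extended_incidence E (T i)" ?S]
      by auto
  qed
  then show ?thesis
    using extended_incidence_in_tree_cone[OF assms(1)] by (auto simp: hilbert_basis_def)
qed

end
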